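(* Let $K=\{e\in\omega:\varphi_e(e)\downarrow\}$ be the halting set. The relation $E^{\mathrm{ce}}_K$ is universal but not computably universal.
   Context: Fix a standard (acceptable) enumeration $(\varphi_e)_{e\in\omega}$ of the partial computable functions and let $W_e=\operatorname{dom}(\varphi_e)$. Write $e=^{\mathrm{ce}}e'$ iff $W_e=W_{e'}$. For $A\subseteq\omega$, define the equivalence relation $E^{\mathrm{ce}}_A$ on $\omega$ by: $i\mathrel{E^{\mathrm{ce}}_A}j$ iff either $W_i\subseteq A$ and $W_j\subseteq A$, or $W_i\not\subseteq A$ and $W_j\not\subseteq A$. An enumeration of a set $B$ is a surjection $\mu:\omega\to B$; $\mu[s]$ denotes the finite string $\mu(0),\dots,\mu(s-1)$. A learner is an arbitrary function $\mathbf{M}:\omega^{<\omega}\to\omega$. For an equivalence relation $E^{\mathrm{ce}}$ on $\omega$ extending $=^{\mathrm{ce}}$, a family $\mathfrak{K}$ of nonempty c.e. sets is $E^{\mathrm{ce}}$-learnable (respectively, computably $E^{\mathrm{ce}}$-learnable) if there is a learner $\mathbf{M}$ (respectively, a computable learner $\mathbf{M}$) such that for every $e$ with $W_e\in\mathfrak{K}$ and every enumeration $\mu$ of $W_e$ there is $i\in\omega$ with $i\mathrel{E^{\mathrm{ce}}}e$ and $\mathbf{M}(\mu[s])=i$ for all sufficiently large $s$; here $\mu$ is not required to be computable. $E^{\mathrm{ce}}$ is universal if every family of nonempty c.e. sets is $E^{\mathrm{ce}}$-learnable, and computably universal if every family of nonempty c.e. sets is computably $E^{\mathrm{ce}}$-learnable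 (equivalently, if $\{W_e:e\in\omega,\ W_e\neq\emptyset\}$ is computably $E^{\mathrm{ce}}$-learnable). *)

theory Defs
  imports Main "HOL-Library.Nat_Bijection"
begin

section \<open>Partial computable functions\<close>

primrec prim_recursion ::
  "(nat list \<Rightarrow> nat option) \<Rightarrow> (nat list \<Rightarrow> nat option) \<Rightarrow> nat \<Rightarrow> nat list \<Rightarrow> nat option"
where
  "prim_recursion f g 0 xs = f xs"
| "prim_recursion f g (Suc k) xs =
     Option.bind (prim_recursion f g k xs) (\<lambda>r. g (k # r # xs))"

text \<open>Unbounded search diverges if an undefined value is met before the first zero.\<close>

definition minimization :: "(nat \<Rightarrow> nat option) \<Rightarrow> nat option" where
  "minimization h =
     (if \<exists>z. h z = Some 0 \<and> (\<forall>y<z. h y \<noteq> None)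
      then Some (LEAST z. h z = Some 0) else None)"

text \<open>Kleene's class of \<open>n\<close>-ary partial recursive functions. An \<open>n\<close>-ary partial function is
  represented on argument lists; only its values on lists of length \<open>n\<close> are meaningful.
  Composition is strict.\<close>

inductive partial_recursive :: "nat \<Rightarrow> (nat list \<Rightarrow> nat option) \<Rightarrow> bool" where
  zero: "partial_recursive n (\<lambda>xs. Some 0)"
| succ: "partial_recursive 1 (\<lambda>xs. Some (Suc (xs ! 0)))"
| proj: "i < n \<Longrightarrow> partial_recursive n (\<lambda>xs. Some (xs ! i))"
| comp: "\<lbrakk>partial_recursive (length gs) f; \<forall>g\<in>set gs. partial_recursive n g\<rbrakk> \<Longrightarrow>
    partial_recursive n
      (\<lambda>xs. if \<forall>g\<in>set gs. g xs \<noteq> None then f (map (\<lambda>g. the (g xs)) gs) else None)"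
| prec: "\<lbrakk>partial_recursive n f; partial_recursive (n + 2) g\<rbrakk> \<Longrightarrow>
    partial_recursive (n + 1) (\<lambda>xs. prim_recursion f g (hd xs) (tl xs))"
| mini: "partial_recursive (n + 1) f \<Longrightarrow>
    partial_recursive n (\<lambda>xs. minimization (\<lambda>z. f (z # xs)))"

definition partial_computable :: "(nat \<Rightarrow> nat option) \<Rightarrow> bool" where
  "partial_computable \<psi> \<longleftrightarrow> (\<exists>f. partial_recursive 1 f \<and> (\<forall>x. \<psi> x = f [x]))"

definition partial_computable2 :: "(nat \<Rightarrow> nat \<Rightarrow> nat option) \<Rightarrow> bool" where
  "partial_computable2 \<psi> \<longleftrightarrow> (\<exists>f. partial_recursive 2 f \<and> (\<forall>x y. \<psi> x y = f [x, y]))"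

definition computable :: "(nat \<Rightarrow> nat) \<Rightarrow> bool" where
  "computable f \<longleftrightarrow> partial_computable (\<lambda>x. Some (f x))"

text \<open>Acceptable (Rogers) numberings: an enumeration of exactly the unary partial computable
  functions that has a computable universal function and satisfies the s-m-n property.\<close>

definition acceptable :: "(nat \<Rightarrow> nat \<Rightarrow> nat option) \<Rightarrow> bool" where
  "acceptable \<phi> \<longleftrightarrow>
     range \<phi> = {\<psi>. partial_computable \<psi>} \<and>
     partial_computable2 \<phi> \<and>
     (\<forall>\<psi>. partial_computable2 \<psi> \<longrightarrow> (\<exists>f. computable f \<and> (\<forall>x. \<phi> (f x) = \<psi> x)))"

definition W :: "(nat \<Rightarrow> nat \<Rightarrow> nat option) \<Rightarrow> nat \<Rightarrow> nat set" where
  "W \<phi> e = dom (\<phi> e)"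

definition halting_set :: "(nat \<Rightarrow> nat \<Rightarrow> nat option) \<Rightarrow> nat set" where
  "halting_set \<phi> = {e. \<phi> e e \<noteq> None}"


section \<open>Learning up to an equivalence relation on indices\<close>

definition eq_ce :: "(nat \<Rightarrow> nat \<Rightarrow> nat option) \<Rightarrow> nat \<Rightarrow> nat \<Rightarrow> bool" where
  "eq_ce \<phi> i j \<longleftrightarrow> W \<phi> i = W \<phi> j"

definition E_ce :: "(nat \<Rightarrow> nat \<Rightarrow> nat option) \<Rightarrow> nat set \<Rightarrow> nat \<Rightarrow> nat \<Rightarrow> bool" where
  "E_ce \<phi> A i j \<longleftrightarrow>
     (W \<phi> i \<subseteq> A \<and> W \<phi> j \<subseteq> A) \<or> (\<not> W \<phi> i \<subseteq> A \<and> \<not> W \<phi> j \<subseteq> A)"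

definition enumeration :: "(nat \<Rightarrow> nat) \<Rightarrow> nat set \<Rightarrow> bool" where
  "enumeration \<mu> B \<longleftrightarrow> range \<mu> = B"

definition initial_segment :: "(nat \<Rightarrow> nat) \<Rightarrow> nat \<Rightarrow> nat list" where
  "initial_segment \<mu> s = map \<mu> [0..<s]"

text \<open>Finite strings are coded by the computable bijection \<^const>\<open>list_encode\<close>.\<close>

definition computable_learner :: "(nat list \<Rightarrow> nat) \<Rightarrow> bool" where
  "computable_learner M \<longleftrightarrow> (\<exists>f. computable f \<and> (\<forall>\<sigma>. M \<sigma> = f (list_encode \<sigma>)))"

definition learns ::
  "(nat \<Rightarrow> nat \<Rightarrow> nat option) \<Rightarrow> (nat \<Rightarrow> nat \<Rightarrow> bool) \<Rightarrow> (nat list \<Rightarrow> nat) \<Rightarrow> nat set set \<Rightarrow> bool"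
where
  "learns \<phi> E M \<KK> \<longleftrightarrow>
     (\<forall>e \<mu>. W \<phi> e \<in> \<KK> \<and> enumeration \<mu> (W \<phi> e) \<longrightarrow>
        (\<exists>i. E i e \<and> (\<exists>s0. \<forall>s\<ge>s0. M (initial_segment \<mu> s) = i)))"

definition learnable ::
  "(nat \<Rightarrow> nat \<Rightarrow> nat option) \<Rightarrow> (nat \<Rightarrow> nat \<Rightarrow> bool) \<Rightarrow> nat set set \<Rightarrow> bool" where
  "learnable \<phi> E \<KK> \<longleftrightarrow> (\<exists>M. learns \<phi> E M \<KK>)"

definition computably_learnable ::
  "(nat \<Rightarrow> nat \<Rightarrow> nat option) \<Rightarrow> (nat \<Rightarrow> nat \<Rightarrow> bool) \<Rightarrow> nat set set \<Rightarrow> bool" where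
  "computably_learnable \<phi> E \<KK> \<longleftrightarrow> (\<exists>M. computable_learner M \<and> learns \<phi> E M \<KK>)"

definition nonempty_ce_family :: "(nat \<Rightarrow> nat \<Rightarrow> nat option) \<Rightarrow> nat set set \<Rightarrow> bool" where
  "nonempty_ce_family \<phi> \<KK> \<longleftrightarrow> \<KK> \<subseteq> {W \<phi> e | e. W \<phi> e \<noteq> {}}"

definition universal ::
  "(nat \<Rightarrow> nat \<Rightarrow> nat option) \<Rightarrow> (nat \<Rightarrow> nat \<Rightarrow> bool) \<Rightarrow> bool" where
  "universal \<phi> E \<longleftrightarrow> (\<forall>\<KK>. nonempty_ce_family \<phi> \<KK> \<longrightarrow> learnable \<phi> E \<KK>)"

definition computably_universal ::
  "(nat \<Rightarrow> nat \<Rightarrow> nat option) \<Rightarrow> (nat \<Rightarrow> nat \<Rightarrow> bool) \<Rightarrow> bool" where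
  "computably_universal \<phi> E \<longleftrightarrow>
     (\<forall>\<KK>. nonempty_ce_family \<phi> \<KK> \<longrightarrow> computably_learnable \<phi> E \<KK>)"

text \<open>Learnability is meant for equivalence relations extending \<^const>\<open>eq_ce\<close>; the relations
  \<^const>\<open>E_ce\<close> are of this kind.\<close>

lemma equivp_E_ce: "equivp (E_ce \<phi> A)"
  by (rule equivpI) (auto simp: reflp_def symp_def transp_def E_ce_def)

lemma E_ce_extends_eq_ce: "eq_ce \<phi> i j \<Longrightarrow> E_ce \<phi> A i j"
  by (auto simp: eq_ce_def E_ce_def)

end

theory Submission
  imports Defs "HOL-Library.Countable_Set"
begin

text \<open>
  A learner that may consult \<open>K\<close> outputs an index of the empty set as long as the data seen so far
  lie in \<open>K\<close>, and an index of \<open>\<omega>\<close> afterwards.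

  Conversely, suppose a computable learner \<open>M\<close> succeeds on all nonempty c.e. sets. Since it converges
  on every enumeration of \<open>K\<close>, there is a locking string \<open>\<sigma>\<close> for \<open>K\<close>: no extension of \<open>\<sigma>\<close> by elements
  of \<open>K\<close> changes the value \<open>i = M \<sigma>\<close>, and \<open>W\<^sub>i \<subseteq> K\<close>. If \<open>x \<in> K\<close>, then \<open>M (\<sigma> x\<^sup>n) = i\<close> for all
  \<open>n\<close>; if \<open>x \<notin> K\<close>, then \<open>\<sigma> x x x \<dots>\<close> enumerates a finite set not contained in \<open>K\<close>, so \<open>M\<close> must
  eventually leave \<open>i\<close>. Hence \<open>x \<notin> K \<longleftrightarrow> (\<exists>n. M (\<sigma> x\<^sup>n) \<noteq> i)\<close>, which makes the complement of
  \<open>K\<close> c.e., contradicting its definition by diagonalization.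
\<close>

section \<open>Closure properties of total recursive functions\<close>

text \<open>Only lists of length \<open>n\<close> are constrained, since a Kleene function is
  meaningful only there. Total functions can thus be written without options, with
  \<open>xs ! i\<close> as the variables.\<close>

definition total_recursive :: "nat \<Rightarrow> (nat list \<Rightarrow> nat) \<Rightarrow> bool" where
  "total_recursive n F \<longleftrightarrow>
     (\<exists>f. partial_recursive n f \<and> (\<forall>xs. length xs = n \<longrightarrow> f xs = Some (F xs)))"

lemma total_recursive_proj: "i < n \<Longrightarrow> total_recursive n (\<lambda>xs. xs ! i)"
  unfolding total_recursive_def using partial_recursive.proj by fastforce

lemma total_recursive_comp:
  assumes "total_recursive (length Gs) F" and "\<And>G. G \<in> set Gs \<Longrightarrow> total_recursive n G"
  shows "total_recursive n (\<lambda>xs. F (map (\<lambda>G. G xs) Gs))"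
proof -
  obtain f where f: "partial_recursive (length Gs) f"
    "\<And>xs. length xs = length Gs \<Longrightarrow> f xs = Some (F xs)"
    using assms(1) unfolding total_recursive_def by blast
  obtain c where c: "\<And>G. G \<in> set Gs \<Longrightarrow> partial_recursive n (c G)"
    "\<And>G xs. G \<in> set Gs \<Longrightarrow> length xs = n \<Longrightarrow> c G xs = Some (G xs)"
    using assms(2) unfolding total_recursive_def by metis
  have "partial_recursive n (\<lambda>xs. if \<forall>g\<in>set (map c Gs). g xs \<noteq> None
      then f (map (\<lambda>g. the (g xs)) (map c Gs)) else None)"
    by (rule partial_recursive.comp) (use f(1) c(1) in auto)
  moreover have "(if \<forall>g\<in>set (map c Gs). g xs \<noteq> None
      then f (map (\<lambda>g. the (g xs)) (map c Gs)) else None) = Some (F (map (\<lambda>G. G xs) Gs))"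
    if "length xs = n" for xs
  proof -
    have "map (\<lambda>g. the (g xs)) (map c Gs) = map (\<lambda>G. G xs) Gs"
      using c(2) that by simp
    moreover have "\<forall>g\<in>set (map c Gs). g xs \<noteq> None"
      using c(2) that by simp
    ultimately show ?thesis using f(2)[of "map (\<lambda>G. G xs) Gs"] by (simp del: map_map)
  qed
  ultimately show ?thesis unfolding total_recursive_def by blast
qed

lemma total_recursive_comp1:
  assumes "total_recursive 1 (\<lambda>xs. F (xs ! 0))" and "total_recursive n G"
  shows "total_recursive n (\<lambda>xs. F (G xs))"
  using total_recursive_comp[of "[G]" "\<lambda>xs. F (xs ! 0)" n] assms by simp

lemma total_recursive_comp2:
  assumes "total_recursive 2 (\<lambda>xs. F (xs ! 0) (xs ! 1))"
    and "total_recursive n G" and "total_recursive n H"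
  shows "total_recursive n (\<lambda>xs. F (G xs) (H xs))"
  using total_recursive_comp[of "[G, H]" "\<lambda>xs. F (xs ! 0) (xs ! 1)" n] assms
  by (auto simp: numeral_2_eq_2)

lemma total_recursive_Suc: "total_recursive n G \<Longrightarrow> total_recursive n (\<lambda>xs. Suc (G xs))"
  by (rule total_recursive_comp1[where F = Suc])
    (use partial_recursive.succ total_recursive_def in auto)

lemma total_recursive_const: "total_recursive n (\<lambda>xs. c)"
proof (induction c)
  case 0
  show ?case unfolding total_recursive_def using partial_recursive.zero by blast
qed (rule total_recursive_Suc)

text \<open>The recursion equations determine \<open>H\<close>, so \<open>H\<close> may be given in
  closed form. \<open>G\<close> receives the counter, the previous value and then the
  parameters.\<close>

lemma total_recursive_prec:
  assumes "total_recursive n F" and "total_recursive (n + 2) G"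
    and "\<And>xs. length xs = n \<Longrightarrow> H (0 # xs) = F xs"
    and "\<And>k xs. length xs = n \<Longrightarrow> H (Suc k # xs) = G (k # H (k # xs) # xs)"
  shows "total_recursive (n + 1) H"
proof -
  obtain f g where f: "partial_recursive n f" "\<And>xs. length xs = n \<Longrightarrow> f xs = Some (F xs)"
    and g: "partial_recursive (n + 2) g" "\<And>xs. length xs = n + 2 \<Longrightarrow> g xs = Some (G xs)"
    using assms(1,2) unfolding total_recursive_def by metis
  have "prim_recursion f g k xs = Some (H (k # xs))" if "length xs = n" for k xs
    by (induction k) (use that f(2) g(2) assms(3,4) in auto)
  then have "prim_recursion f g (hd xs) (tl xs) = Some (H xs)" if "length xs = n + 1" for xs
    using that by (cases xs) auto
  then show ?thesis
    unfolding total_recursive_def using partial_recursive.prec[OF f(1) g(1)] by blast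
qed

lemma total_recursive_add:
  assumes "total_recursive n F" and "total_recursive n G"
  shows "total_recursive n (\<lambda>xs. F xs + G xs)"
proof (rule total_recursive_comp2[OF _ assms])
  have "total_recursive (1 + 1) (\<lambda>xs. xs ! 0 + xs ! 1)"
    by (rule total_recursive_prec[where F = "\<lambda>xs. xs ! 0" and G = "\<lambda>xs. Suc (xs ! 1)"])
      (auto intro!: total_recursive_proj total_recursive_Suc)
  then show "total_recursive 2 (\<lambda>xs. xs ! 0 + xs ! 1)" by (simp add: numeral_2_eq_2)
qed

lemma total_recursive_triangle:
  assumes "total_recursive n F"
  shows "total_recursive n (\<lambda>xs. triangle (F xs))"
proof (rule total_recursive_comp1[OF _ assms])
  have "total_recursive (0 + 1) (\<lambda>xs. triangle (xs ! 0))"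
    by (rule total_recursive_prec[where F = "\<lambda>xs. 0" and G = "\<lambda>xs. xs ! 1 + Suc (xs ! 0)"])
      (auto intro!: total_recursive_proj total_recursive_Suc total_recursive_add
         total_recursive_const)
  then show "total_recursive 1 (\<lambda>xs. triangle (xs ! 0))" by simp
qed

lemma total_recursive_prod_encode:
  assumes "total_recursive n F" and "total_recursive n G"
  shows "total_recursive n (\<lambda>xs. prod_encode (F xs, G xs))"
  unfolding prod_encode_def using assms
  by (auto intro!: total_recursive_add total_recursive_triangle)

text \<open>Needed to run a computable learner on \<open>\<sigma>\<close> followed by
  \<open>n\<close> copies of \<open>x\<close>, uniformly in \<open>n\<close> and \<open>x\<close>.
  Each further letter in front of a string with code \<open>c\<close> gives
  \<open>Suc (prod_encode (letter, c))\<close>.\<close>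

lemma total_recursive_encode_append_replicate:
  "total_recursive 2 (\<lambda>xs. list_encode (\<sigma> @ replicate (xs ! 0) (xs ! 1)))"
proof (induction \<sigma>)
  case Nil
  have "total_recursive (1 + 1) (\<lambda>xs. list_encode (replicate (xs ! 0) (xs ! 1)))"
    \<comment> \<open>Recursion on the number of copies: \<open>xs ! 1\<close> is the previous code
      and \<open>xs ! 2\<close> the repeated letter; the empty list has code 0.\<close>
    by (rule total_recursive_prec[where F = "\<lambda>xs. 0"
          and G = "\<lambda>xs. Suc (prod_encode (xs ! 2, xs ! 1))"])
      (auto intro!: total_recursive_proj total_recursive_Suc total_recursive_prod_encode
         total_recursive_const)
  then show ?case by (simp add: numeral_2_eq_2)
next
  case (Cons a \<sigma>)
  then show ?case
    by (auto intro!: total_recursive_Suc total_recursive_prod_encode total_recursive_const)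
qed

text \<open>Induction on the threshold: \<open>h\<close> arises from \<open>h 0\<close> and
  \<open>h \<circ> Suc\<close> by a primitive recursion that ignores the previous value. This covers
  tests for membership in a finite set and for equality with a fixed number.\<close>

lemma total_recursive_eventually_const:
  assumes "\<And>v. v \<ge> N \<Longrightarrow> h v = c"
  shows "total_recursive 1 (\<lambda>xs. h (xs ! 0))"
  using assms
proof (induction N arbitrary: h)
  case 0
  then show ?case by (simp add: total_recursive_const)
next
  case (Suc N)
  have "total_recursive 1 (\<lambda>xs. (h \<circ> Suc) (xs ! 0))"
    by (rule Suc.IH) (use Suc.prems in auto)
  then have "total_recursive (0 + 2) (\<lambda>xs. (h \<circ> Suc) (xs ! 0))"
    by (rule total_recursive_comp1) (simp add: total_recursive_proj)
  then have "total_recursive (0 + 1) (\<lambda>xs. h (xs ! 0))"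
    by (rule total_recursive_prec[OF total_recursive_const[of 0 "h 0"]]) simp_all
  then show ?case by simp
qed

lemma total_recursive_computable:
  assumes "computable f" and "total_recursive n G"
  shows "total_recursive n (\<lambda>xs. f (G xs))"
proof (rule total_recursive_comp1[OF _ assms(2)])
  obtain g where g: "partial_recursive 1 g" "\<And>x. Some (f x) = g [x]"
    using assms(1) unfolding computable_def partial_computable_def by blast
  have "g xs = Some (f (xs ! 0))" if "length xs = 1" for xs
    using that g(2) by (auto simp: length_Suc_conv)
  then show "total_recursive 1 (\<lambda>xs. f (xs ! 0))"
    unfolding total_recursive_def using g(1) by blast
qed

lemma minimization_total: "minimization (\<lambda>z. Some (h z)) \<noteq> None \<longleftrightarrow> (\<exists>z. h z = 0)"
  by (simp add: minimization_def)

text \<open>The function sends \<open>x\<close> to the least \<open>n\<close> with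
  \<open>H [n, x] = 0\<close>; \<open>mini\<close> searches over the head of the list, hence the
  order of the arguments.\<close>

lemma ex_domain_partial_computable:
  assumes "total_recursive 2 H"
  shows "\<exists>\<psi>. partial_computable \<psi> \<and> dom \<psi> = {x. \<exists>n. H [n, x] = 0}"
proof -
  obtain h where h: "partial_recursive (1 + 1) h"
    "\<And>xs. length xs = 2 \<Longrightarrow> h xs = Some (H xs)"
    using assms unfolding total_recursive_def by (auto simp: numeral_2_eq_2)
  define \<psi> where "\<psi> = (\<lambda>x. minimization (\<lambda>z. h [z, x]))"
  have "partial_computable \<psi>"
    unfolding partial_computable_def \<psi>_def using partial_recursive.mini[OF h(1)] by blast
  moreover have "dom \<psi> = {x. \<exists>n. H [n, x] = 0}"
    unfolding \<psi>_def dom_def using h(2) minimization_total by simp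
  ultimately show ?thesis by blast
qed

section \<open>Enumerations and locking strings\<close>

definition prepend :: "'a list \<Rightarrow> (nat \<Rightarrow> 'a) \<Rightarrow> nat \<Rightarrow> 'a" where
  "prepend \<sigma> \<mu> k = (if k < length \<sigma> then \<sigma> ! k else \<mu> (k - length \<sigma>))"

lemma initial_segment_prepend:
  "initial_segment (prepend \<sigma> \<mu>) (length \<sigma> + n) = \<sigma> @ initial_segment \<mu> n"
  by (rule nth_equalityI) (auto simp: initial_segment_def prepend_def nth_append)

lemma range_prepend: "range (prepend \<sigma> \<mu>) = set \<sigma> \<union> range \<mu>"
proof
  show "range (prepend \<sigma> \<mu>) \<subseteq> set \<sigma> \<union> range \<mu>" by (auto simp: prepend_def)
  have "\<sigma> ! k \<in> range (prepend \<sigma> \<mu>)" if "k < length \<sigma>" for k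
    using that by (auto simp: prepend_def image_iff intro!: exI[of _ k])
  moreover have "\<mu> k \<in> range (prepend \<sigma> \<mu>)" for k
    by (auto simp: prepend_def image_iff intro!: exI[of _ "k + length \<sigma>"])
  ultimately show "set \<sigma> \<union> range \<mu> \<subseteq> range (prepend \<sigma> \<mu>)"
    by (auto simp: in_set_conv_nth)
qed

text \<open>The diagonal \<open>S (Suc k) ! k\<close> works: the length bound makes position
  \<open>k\<close> exist at stage \<open>Suc k\<close>, and any two stages agree wherever both are
  defined.\<close>

lemma ex_limit_of_prefix_chain:
  fixes S :: "nat \<Rightarrow> nat list"
  assumes step: "\<And>n. \<exists>\<rho>. S (Suc n) = S n @ \<rho>" and len: "\<And>n. n \<le> length (S n)"
  obtains \<mu> where "\<And>n. initial_segment \<mu> (length (S n)) = S n"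
proof
  have chain: "\<exists>\<rho>. S (m + d) = S m @ \<rho>" for m d
  proof (induction d)
    case (Suc d)
    then show ?case using step[of "m + d"] by fastforce
  qed simp
  have *: "S m ! k = S n ! k" if "k < length (S m)" "m \<le> n" for k m n
    using chain[of m "n - m"] that by (auto simp: nth_append)
  have "S (Suc k) ! k = S n ! k" if "k < length (S n)" for k n
  proof (cases "n \<le> Suc k")
    case True
    from *[OF that True] show ?thesis by (rule sym)
  next
    case False
    then show ?thesis using len[of "Suc k"] by (intro *) linarith+
  qed
  then show "initial_segment (\<lambda>k. S (Suc k) ! k) (length (S n)) = S n" for n
    by (intro nth_equalityI) (auto simp: initial_segment_def)
qed

text \<open>Otherwise every string over \<open>B\<close> has an extension over \<open>B\<close> on
  which \<open>M\<close> changes its value. Iterating such extensions yields an enumeration of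
  \<open>B\<close> on which \<open>M\<close> never settles.\<close>

lemma ex_locking_string:
  fixes M :: "nat list \<Rightarrow> 'b"
  assumes "B \<noteq> {}"
    and conv: "\<And>\<mu>. enumeration \<mu> B \<Longrightarrow> \<exists>i s0. \<forall>s\<ge>s0. M (initial_segment \<mu> s) = i"
  shows "\<exists>\<sigma>. set \<sigma> \<subseteq> B \<and> (\<forall>\<tau>. set \<tau> \<subseteq> B \<longrightarrow> M (\<sigma> @ \<tau>) = M \<sigma>)"
proof (rule ccontr)
  assume "\<not> ?thesis"
  then obtain ext where ext: "\<And>\<sigma>. set \<sigma> \<subseteq> B \<Longrightarrow> set (ext \<sigma>) \<subseteq> B \<and> M (\<sigma> @ ext \<sigma>) \<noteq> M \<sigma>"
    by metis
  define \<nu> where "\<nu> = from_nat_into B"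
  have \<nu>: "range \<nu> = B"
    unfolding \<nu>_def by (rule range_from_nat_into[OF \<open>B \<noteq> {}\<close>]) simp
  \<comment> \<open>The letter \<open>\<nu> n\<close> forces the limit to exhaust \<open>B\<close>,
    and also makes each stage strictly longer.\<close>
  define S where "S = rec_nat [] (\<lambda>n \<sigma>. \<sigma> @ ext \<sigma> @ [\<nu> n])"
  have S: "S 0 = []" "\<And>n. S (Suc n) = S n @ ext (S n) @ [\<nu> n]"
    by (simp_all add: S_def)
  have sub: "set (S n) \<subseteq> B" for n
  proof (induction n)
    case (Suc n)
    moreover have "set (ext (S n)) \<subseteq> B" using ext[OF Suc] by blast
    moreover have "\<nu> n \<in> B" using \<nu> by blast
    ultimately show ?case by (simp add: S)
  qed (simp add: S)
  have len: "n \<le> length (S n)" for n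
    by (induction n) (auto simp: S)
  obtain \<mu> where \<mu>: "\<And>n. initial_segment \<mu> (length (S n)) = S n"

  proof (rule ex_limit_of_prefix_chain[of S])
    show "\<exists>\<rho>. S (Suc n) = S n @ \<rho>" for n by (simp add: S)
  qed (use len in auto)
  have seg: "set (initial_segment \<mu> s) \<subseteq> range \<mu>" for s
    by (auto simp: initial_segment_def)
  have "\<mu> k \<in> B" for k
  proof -
    have "\<mu> k \<in> set (initial_segment \<mu> (length (S (Suc k))))"
      using len[of "Suc k"] by (auto simp: initial_segment_def)
    then show ?thesis using sub[of "Suc k"] by (auto simp: \<mu>)
  qed
  moreover have "\<nu> n \<in> range \<mu>" for n
    using seg[of "length (S (Suc n))"] unfolding \<mu> by (simp add: S)
  ultimately have "enumeration \<mu> B"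
    unfolding enumeration_def using \<nu> by blast
  then obtain i s0 where lim: "\<And>s. s \<ge> s0 \<Longrightarrow> M (initial_segment \<mu> s) = i"
    using conv by blast
  \<comment> \<open>Dropping the last letter of stage \<open>Suc s0\<close> leaves the point just
    after the value has changed; it and stage \<open>s0\<close> both lie beyond the supposed point
    of convergence.\<close>
  define t where "t = length (S s0 @ ext (S s0))"
  have "initial_segment \<mu> t = take t (initial_segment \<mu> (length (S (Suc s0))))"
    by (simp add: initial_segment_def take_map S t_def)
  also have "\<dots> = S s0 @ ext (S s0)"
    unfolding \<mu> by (simp add: S t_def)
  finally have "M (S s0 @ ext (S s0)) = i"
    using lim[of t] len[of s0] by (simp add: t_def)
  moreover have "M (S s0) = i"
    using lim[OF len[of s0]] \<mu> by simp
  ultimately show False using ext[OF sub[of s0]] by simp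
qed

section \<open>Indices of particular c.e. sets\<close>

lemma acceptable_index:
  assumes "acceptable \<phi>" and "partial_computable \<psi>"
  obtains e where "\<phi> e = \<psi>"
proof -
  have "\<psi> \<in> range \<phi>" using assms unfolding acceptable_def by simp
  then show thesis using that by blast
qed

lemma acceptable_ce_index:
  assumes "acceptable \<phi>" and "total_recursive 2 H"
  obtains e where "W \<phi> e = {x. \<exists>n. H [n, x] = 0}"
  using ex_domain_partial_computable[OF assms(2)] acceptable_index[OF assms(1)]
  unfolding W_def by metis

lemma acceptable_UNIV_index:
  assumes "acceptable \<phi>"
  obtains e where "W \<phi> e = UNIV"
  using acceptable_ce_index[OF assms total_recursive_const[of 2 0]] by auto

lemma acceptable_finite_index:
  assumes "acceptable \<phi>" and "finite F"
  obtains e where "W \<phi> e = F"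
proof -
  define h :: "nat \<Rightarrow> nat" where "h v = (if v \<in> F then 0 else 1)" for v
  obtain N where N: "\<forall>v\<in>F. v < N"
    using assms(2) finite_nat_set_iff_bounded by blast
  have "h v = 1" if "v \<ge> N" for v
    using N that unfolding h_def by (meson leD)
  then have "total_recursive 1 (\<lambda>xs. h (xs ! 0))"
    by (rule total_recursive_eventually_const)
  \<comment> \<open>The search variable \<open>xs ! 0\<close> is ignored, so the search succeeds at
    once or never.\<close>
  then have "total_recursive 2 (\<lambda>xs. h (xs ! 1))"
    by (rule total_recursive_comp1) (simp add: total_recursive_proj)
  from acceptable_ce_index[OF assms(1) this] obtain e where "W \<phi> e = {x. h x = 0}" by auto
  then have "W \<phi> e = F" by (auto simp: h_def split: if_splits)
  then show thesis by (rule that)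
qed

lemma halting_set_index:
  assumes "acceptable \<phi>"
  obtains e where "W \<phi> e = halting_set \<phi>"
proof -
  obtain f where f: "partial_recursive 2 f" "\<And>x y. \<phi> x y = f [x, y]"
    using assms unfolding acceptable_def partial_computable2_def by blast
  define p :: "nat list \<Rightarrow> nat option" where "p = (\<lambda>xs. Some (xs ! 0))"
  \<comment> \<open>The universal function is composed with two copies of the projection
    \<open>p\<close>, which gives the diagonal \<open>\<phi> x x\<close>.\<close>
  have "partial_recursive 1 (\<lambda>xs. if \<forall>g\<in>set [p, p]. g xs \<noteq> None
      then f (map (\<lambda>g. the (g xs)) [p, p]) else None)"
    by (rule partial_recursive.comp)
      (use f(1) in \<open>auto simp: p_def numeral_2_eq_2 intro!: partial_recursive.proj\<close>)
  then have "partial_recursive 1 (\<lambda>xs. f [xs ! 0, xs ! 0])" by (simp add: p_def)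
  moreover have "\<forall>x. \<phi> x x = (\<lambda>xs. f [xs ! 0, xs ! 0]) [x]" by (simp add: f(2))
  ultimately have "partial_computable (\<lambda>x. \<phi> x x)"
    unfolding partial_computable_def by blast
  from acceptable_index[OF assms this] obtain e where "\<phi> e = (\<lambda>x. \<phi> x x)" .
  then have "W \<phi> e = halting_set \<phi>"
    by (auto simp: W_def halting_set_def dom_def)
  then show thesis by (rule that)
qed

text \<open>The number \<open>e\<close> itself separates the two sets: it lies in
  \<open>W \<phi> e\<close> iff it lies in the halting set.\<close>

lemma compl_halting_set_not_ce: "W \<phi> e \<noteq> - halting_set \<phi>"
  by (auto simp: W_def halting_set_def)

section \<open>Learning with and without computability\<close>

lemma E_ce_learnable_of_not_subset:
  assumes "W \<phi> a \<subseteq> A" and "\<not> W \<phi> b \<subseteq> A"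
  shows "learnable \<phi> (E_ce \<phi> A) \<KK>"
proof -
  define M where "M \<sigma> = (if set \<sigma> \<subseteq> A then a else b)" for \<sigma>
  have "\<exists>i. E_ce \<phi> A i e \<and> (\<exists>s0. \<forall>s\<ge>s0. M (initial_segment \<mu> s) = i)"
    if \<mu>: "range \<mu> = W \<phi> e" for e \<mu>
  proof (cases "W \<phi> e \<subseteq> A")
    case True
    then have "M (initial_segment \<mu> s) = a" for s
      using \<mu> by (auto simp: M_def initial_segment_def)
    moreover have "E_ce \<phi> A a e" using True assms by (simp add: E_ce_def)
    ultimately show ?thesis by blast
  next
    case False
    then obtain k where "\<mu> k \<notin> A" unfolding \<mu>[symmetric] by blast
    \<comment> \<open>Length \<open>Suc k\<close> is the first at which \<open>\<mu> k\<close> must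
      have been seen; from then on the answer cannot revert.\<close>
    then have "\<forall>s\<ge>Suc k. M (initial_segment \<mu> s) = b"
      by (auto simp: M_def initial_segment_def image_subset_iff)
    moreover have "E_ce \<phi> A b e" using False assms by (simp add: E_ce_def)
    ultimately show ?thesis by blast
  qed
  then show ?thesis unfolding learnable_def learns_def enumeration_def by blast
qed

lemma compl_ce_of_computably_learnable:
  assumes acc: "acceptable \<phi>" and A: "W \<phi> k = A" "A \<noteq> {}"
    and learn: "computably_learnable \<phi> (E_ce \<phi> A) {W \<phi> e | e. W \<phi> e \<noteq> {}}"
  obtains c where "W \<phi> c = - A"
proof -
  obtain M f where f: "computable f" and M: "\<And>\<sigma>. M \<sigma> = f (list_encode \<sigma>)"
    and "learns \<phi> (E_ce \<phi> A) M {W \<phi> e | e. W \<phi> e \<noteq> {}}"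
    using learn unfolding computably_learnable_def computable_learner_def by blast
  \<comment> \<open>A set of the form \<open>range \<mu>\<close> is nonempty, so membership in the
    family is automatic.\<close>
  then have lim: "\<exists>i. E_ce \<phi> A i e \<and> (\<exists>s0. \<forall>s\<ge>s0. M (initial_segment \<mu> s) = i)"
    if "range \<mu> = W \<phi> e" for e \<mu>
    using that unfolding learns_def enumeration_def by blast
  obtain \<sigma> where \<sigma>: "set \<sigma> \<subseteq> A" and lock: "\<And>\<tau>. set \<tau> \<subseteq> A \<Longrightarrow> M (\<sigma> @ \<tau>) = M \<sigma>"
    using ex_locking_string[OF A(2), of M] lim A(1) unfolding enumeration_def by metis
  define i where "i = M \<sigma>"
  have "W \<phi> i \<subseteq> A"
  proof -
    define \<nu> where "\<nu> = from_nat_into A"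
    have \<nu>: "range \<nu> = A"
      unfolding \<nu>_def by (rule range_from_nat_into[OF A(2)]) simp
    \<comment> \<open>On this enumeration of \<open>A\<close> the learner stays at \<open>i\<close>
      once \<open>\<sigma>\<close> has been read, so \<open>i\<close> is its limit and must be
      equivalent to \<open>k\<close>.\<close>
    have "range (prepend \<sigma> \<nu>) = W \<phi> k"
      using \<sigma> \<nu> A(1) by (auto simp: range_prepend)
    from lim[OF this] obtain j s0 where j: "E_ce \<phi> A j k"
      "\<And>s. s \<ge> s0 \<Longrightarrow> M (initial_segment (prepend \<sigma> \<nu>) s) = j" by blast
    have "set (initial_segment \<nu> s0) \<subseteq> A" using \<nu> by (auto simp: initial_segment_def)
    from lock[OF this] have "j = i"
      using j(2)[of "length \<sigma> + s0"] by (simp add: initial_segment_prepend i_def)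
    then show ?thesis using j(1) A(1) by (auto simp: E_ce_def)
  qed
  have compl: "(\<exists>n. M (\<sigma> @ replicate n x) \<noteq> i) \<longleftrightarrow> x \<notin> A" for x
  proof
    assume "\<exists>n. M (\<sigma> @ replicate n x) \<noteq> i"
    then show "x \<notin> A" using lock unfolding i_def by (metis in_set_replicate subsetI)
  next
    assume x: "x \<notin> A"
    \<comment> \<open>Success of \<open>M\<close> on this finite set, which is not contained in
      \<open>A\<close>, forces a limit inequivalent to \<open>i\<close>.\<close>
    obtain e where e: "W \<phi> e = set \<sigma> \<union> {x}"
      using acceptable_finite_index[OF acc, of "set \<sigma> \<union> {x}"] by auto
    have "range (prepend \<sigma> (\<lambda>_. x)) = W \<phi> e" by (simp add: range_prepend e)
    from lim[OF this] obtain j s0 where j: "E_ce \<phi> A j e"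
      "\<And>s. s \<ge> s0 \<Longrightarrow> M (initial_segment (prepend \<sigma> (\<lambda>_. x)) s) = j" by blast
    have "M (\<sigma> @ replicate s0 x) = j"
      using j(2)[of "length \<sigma> + s0"]
      unfolding initial_segment_prepend
      by (simp add: initial_segment_def map_replicate_const)
    moreover have "j \<noteq> i" using j(1) e x \<open>W \<phi> i \<subseteq> A\<close> by (auto simp: E_ce_def)
    ultimately show "\<exists>n. M (\<sigma> @ replicate n x) \<noteq> i" by blast
  qed
  \<comment> \<open>\<open>h\<close> vanishes exactly on the guesses other than \<open>i\<close>,
    turning a change of mind into a zero that unbounded search can find.\<close>
  define h :: "nat \<Rightarrow> nat" where "h v = (if v = i then 1 else 0)" for v
  have "total_recursive 1 (\<lambda>xs. h (xs ! 0))"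
    by (rule total_recursive_eventually_const[where N = "Suc i" and c = 0]) (simp add: h_def)
  then have "total_recursive 2 (\<lambda>xs. h (M (\<sigma> @ replicate (xs ! 0) (xs ! 1))))"
    unfolding M
    by (rule total_recursive_comp1)
      (rule total_recursive_computable[OF f total_recursive_encode_append_replicate])
  from acceptable_ce_index[OF acc this] obtain c
    where "W \<phi> c = {x. \<exists>n. h (M (\<sigma> @ replicate n x)) = 0}" by auto
  then have "W \<phi> c = - A" using compl by (auto simp: h_def split: if_splits)
  then show thesis by (rule that)
qed

theorem theorem6p4:
  fixes \<phi> :: "nat \<Rightarrow> nat \<Rightarrow> nat option"
  assumes "acceptable \<phi>"
  shows "universal \<phi> (E_ce \<phi> (halting_set \<phi>)) \<and>
         \<not> computably_universal \<phi> (E_ce \<phi> (halting_set \<phi>))"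
proof -
  obtain a where a: "W \<phi> a = {}" using acceptable_finite_index[OF assms, of "{}"] by auto
  obtain b where b: "W \<phi> b = UNIV" using acceptable_UNIV_index[OF assms] .
  obtain k where k: "W \<phi> k = halting_set \<phi>" using halting_set_index[OF assms] .
  \<comment> \<open>A nowhere defined function diverges and a total one converges on its own index.
    So \<open>a\<close> shows that the halting set omits a point of \<open>W \<phi> b\<close>, and
    \<open>b\<close> that it is nonempty.\<close>
  have "a \<notin> halting_set \<phi>" "b \<in> halting_set \<phi>"
    using a b by (auto simp: W_def halting_set_def)
  then have "universal \<phi> (E_ce \<phi> (halting_set \<phi>))"
    unfolding universal_def using a b E_ce_learnable_of_not_subset[of \<phi> a _ b] by blast
  moreover have "\<not> computably_universal \<phi> (E_ce \<phi> (halting_set \<phi>))"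
  proof
    assume "computably_universal \<phi> (E_ce \<phi> (halting_set \<phi>))"
    then have "computably_learnable \<phi> (E_ce \<phi> (halting_set \<phi>)) {W \<phi> e | e. W \<phi> e \<noteq> {}}"
      unfolding computably_universal_def nonempty_ce_family_def by blast
    from compl_ce_of_computably_learnable[OF assms k _ this] \<open>b \<in> halting_set \<phi>\<close>
    show False using compl_halting_set_not_ce by blast
  qed
  ultimately show ?thesis by blast
qed

end
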